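(* Let $h\geq 1$ and $n\geq 1$ be integers and let $\mathbf{t}=(t_1,\dots,t_n)$ be an $h$-depth neighborhood, i.e. an $n$-tuple of unlabeled rooted trees each of depth at most $h$. Then $\mathbf{t}$ is graphical if and only if both of the following hold: (i) for every type $\tau\in\Delta$, the integer sequence $(d^\tau_i)_{i\in[n]}$ is graphical, i.e. there is a simple graph on vertex set $[n]$ in which vertex $i$ has degree $d^\tau_i$ for all $i$; (ii) for every $\tau\in A$, the double sequence $(d^\tau_i,d^{\tau^{-1}}_i)_{i\in[n]}$ is digraphical, i.e. there is a digraph on vertex set $[n]$ without loops and without multiple parallel arcs in which vertex $i$ has out-degree $d^\tau_i$ and in-degree $d^{\tau^{-1}}_i$ for all $i$.
   Context: All trees are unlabeled rooted trees; the root is denoted $\bullet$, and for a rooted tree $g$ and integer $k$, $(g)_k$ is the ball of radius $k$ around the root. For a graph $G$ and a vertex $x$, the universal covering tree $T_G$ rooted at $x$ can be described as the tree whose vertices are the non-backtracking walks in $G$ starting at $x$ (rooted at the trivial walk), a walk being adjacent to its one-step extensions; the $h$-depth universal covering neighborhood of $x$ is the ball of radius $h$ around the root in this tree, as an unlabeled rooted tree. The tuple $\mathbf{t}$ is called graphical if there exists a simple graph $G$ on vertex set $[n]=\{1,\dots,n\}$ such that for every $i$, the $h$-depth universal covering neighborhood of $i$ in $G$ is isomorphic (as a rooted tree) to $t_i$. Type of an edge: let $t$ be a rooted tree of depth at most $h$ and $e=(\bullet,x)$ an edge incident to the root. Removing $e$ splits $t$ into two components: $r'$ containing the root, and $s$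 containing $x$, which is rooted at $x$. Deleting from $r'$ all vertices that were at depth exactly $h$ in $t$ (keeping root $\bullet$) gives a rooted tree $r$. The type of $e$ is $\tau(e)=(r,s)$, a pair of unlabeled rooted trees of depth at most $h-1$. For a pair $\tau=(r,s)$ its opposite is $\tau^{-1}=(s,r)$. Let $\mathrm{types}(\mathbf{t})$ be the set of types of all root-incident edges of all the $t_i$. Let $\Delta$ be the set of types in $\mathrm{types}(\mathbf{t})$ of the form $(r,r)$. Let $A$ be a set of pairs $(r,s)$ with $r\neq s$ such that for every $\tau=(r,s)\in\mathrm{types}(\mathbf{t})$ with $r\ne s$, exactly one of $\tau,\tau^{-1}$ lies in $A$ (and $A$ contains no other pairs). For any pair $\tau$ and $i\in[n]$, $d^\tau_i$ is the number of edges of $t_i$ incident to the root whose type is $\tau$ (possibly $0$). *)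

theory Defs
  imports Main "HOL-Library.Multiset"
begin

(* Finite unlabeled rooted trees. Since the branches at the root form a multiset,
   equality on this type is isomorphism of rooted trees. *)
datatype rtree = Node (children: "rtree multiset")

primrec depth :: "rtree \<Rightarrow> nat" where
  "depth (Node M) = Max (insert 0 (Suc ` set_mset (image_mset depth M)))"

primrec tree_ball :: "nat \<Rightarrow> rtree \<Rightarrow> rtree" where
  "tree_ball 0 t = Node {#}"
| "tree_ball (Suc k) t = Node (image_mset (tree_ball k) (children t))"

record 'v rooted_graph =
  verts :: "'v set"
  edges :: "'v rel"
  root :: 'v

definition rooted_iso :: "'v rooted_graph \<Rightarrow> 'w rooted_graph \<Rightarrow> bool" where
  "rooted_iso G H \<longleftrightarrow> (\<exists>f. bij_betw f (verts G) (verts H) \<and> f (root G) = root H \<and>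
     (\<forall>u\<in>verts G. \<forall>v\<in>verts G. (u, v) \<in> edges G \<longleftrightarrow> (f u, f v) \<in> edges H))"

definition graph_ball :: "nat \<Rightarrow> 'v rooted_graph \<Rightarrow> 'v rooted_graph" where
  "graph_ball k G = (let B = {v \<in> verts G. \<exists>j\<le>k. (root G, v) \<in> edges G ^^ j}
     in \<lparr>verts = B, edges = edges G \<inter> B \<times> B, root = root G\<rparr>)"

definition extension_edges :: "'a list set \<Rightarrow> 'a list rel" where
  "extension_edges V = {(p, q). p \<in> V \<and> q \<in> V \<and> (\<exists>c. q = p @ [c] \<or> p = q @ [c])}"

(* A tree as a concrete graph: a vertex is the downward path leading to it, where a step (s, i)
   enters the i-th copy of the branch s. *)
primrec path_in :: "(rtree \<times> nat) list \<Rightarrow> rtree \<Rightarrow> bool" where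
  "path_in [] t \<longleftrightarrow> True"
| "path_in (c # p) t \<longleftrightarrow> snd c < count (children t) (fst c) \<and> path_in p (fst c)"

definition graph_of_tree :: "rtree \<Rightarrow> (rtree \<times> nat) list rooted_graph" where
  "graph_of_tree t =
     \<lparr>verts = {p. path_in p t}, edges = extension_edges {p. path_in p t}, root = []\<rparr>"

definition simple_graph :: "nat \<Rightarrow> nat rel \<Rightarrow> bool" where
  "simple_graph n G \<longleftrightarrow> G \<subseteq> {1..n} \<times> {1..n} \<and> sym G \<and> irrefl G"

(* Opposite arcs are allowed; parallel arcs are excluded because the arcs form a set of pairs. *)
definition simple_digraph :: "nat \<Rightarrow> nat rel \<Rightarrow> bool" where
  "simple_digraph n D \<longleftrightarrow> D \<subseteq> {1..n} \<times> {1..n} \<and> irrefl D"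

definition nb_walks :: "'v rel \<Rightarrow> 'v \<Rightarrow> 'v list set" where
  "nb_walks G x = {w. w \<noteq> [] \<and> hd w = x \<and> successively (\<lambda>u v. (u, v) \<in> G) w \<and>
     (\<forall>k. k + 2 < length w \<longrightarrow> w ! k \<noteq> w ! (k + 2))}"

definition universal_cover :: "'v rel \<Rightarrow> 'v \<Rightarrow> 'v list rooted_graph" where
  "universal_cover G x =
     \<lparr>verts = nb_walks G x, edges = extension_edges (nb_walks G x), root = [x]\<rparr>"

definition graphical_nbhd :: "nat \<Rightarrow> nat \<Rightarrow> (nat \<Rightarrow> rtree) \<Rightarrow> bool" where
  "graphical_nbhd h n t \<longleftrightarrow> (\<exists>G. simple_graph n G \<and>
     (\<forall>i\<in>{1..n}. rooted_iso (graph_ball h (universal_cover G i)) (graph_of_tree (t i))))"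

(* The type of a root edge of t leading to a branch s. For depth t \<le> h, restricting to the ball of
   radius h - 1 deletes exactly the vertices at depth h. *)
definition edge_type :: "nat \<Rightarrow> rtree \<Rightarrow> rtree \<Rightarrow> rtree \<times> rtree" where
  "edge_type h t s = (tree_ball (h - 1) (Node (children t - {#s#})), s)"

definition types :: "nat \<Rightarrow> nat \<Rightarrow> (nat \<Rightarrow> rtree) \<Rightarrow> (rtree \<times> rtree) set" where
  "types h n t = {edge_type h (t i) s | i s. i \<in> {1..n} \<and> s \<in># children (t i)}"

definition type_degree :: "nat \<Rightarrow> rtree \<times> rtree \<Rightarrow> rtree \<Rightarrow> nat" where
  "type_degree h \<tau> t = size {#s \<in># children t. edge_type h t s = \<tau>#}"

definition diagonal_types :: "nat \<Rightarrow> nat \<Rightarrow> (nat \<Rightarrow> rtree) \<Rightarrow> (rtree \<times> rtree) set" where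
  "diagonal_types h n t = {(r, s) \<in> types h n t. r = s}"

definition orientation :: "(rtree \<times> rtree) set \<Rightarrow> (rtree \<times> rtree) set \<Rightarrow> bool" where
  "orientation T A \<longleftrightarrow>
     (\<forall>(r, s)\<in>A. r \<noteq> s \<and> ((r, s) \<in> T \<or> (s, r) \<in> T)) \<and>
     (\<forall>(r, s)\<in>T. r \<noteq> s \<longrightarrow> ((r, s) \<in> A) \<noteq> ((s, r) \<in> A))"

definition graphical_seq :: "nat \<Rightarrow> (nat \<Rightarrow> nat) \<Rightarrow> bool" where
  "graphical_seq n d \<longleftrightarrow> (\<exists>G. simple_graph n G \<and> (\<forall>i\<in>{1..n}. card (G `` {i}) = d i))"

definition digraphical_seq :: "nat \<Rightarrow> (nat \<Rightarrow> nat) \<Rightarrow> (nat \<Rightarrow> nat) \<Rightarrow> bool" where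
  "digraphical_seq n dout din \<longleftrightarrow> (\<exists>D. simple_digraph n D \<and>
     (\<forall>i\<in>{1..n}. card (D `` {i}) = dout i \<and> card (D\<inverse> `` {i}) = din i))"

end

theory Submission imports Defs begin

text \<open>
  Necessity: in a realization \<open>G\<close>, the arcs of a fixed type \<open>\<tau>\<close> form a graph (if \<open>\<tau>\<close> is diagonal) or a
  digraph with the prescribed degrees.

  Sufficiency: take the union of the given graphs and digraphs over all types. If \<open>(r, s)\<close> is the type
  of an edge between \<open>i\<close> and \<open>j\<close>, the ball of radius \<open>k + 1\<close> in \<open>t\<^sub>i\<close> consists of the ball of radius
  \<open>k + 1\<close> in \<open>r\<close> and the ball of radius \<open>k\<close> in \<open>s\<close>, attached to the root of \<open>r\<close>, and symmetrically for
  \<open>t\<^sub>j\<close>. Hence \<open>t\<^sub>i\<close> and \<open>t\<^sub>j\<close> determine \<open>(r, s)\<close>, by induction on \<open>k\<close>. So the pieces never overlap,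
  the union is simple, and its universal covers are read off by unfolding the types level by level.
\<close>

section \<open>Prefix-closed sets of lists as trees\<close>

definition prefix_closed :: "'a list set \<Rightarrow> bool" where
  "prefix_closed V \<longleftrightarrow> [] \<in> V \<and> (\<forall>p q. p @ q \<in> V \<longrightarrow> p \<in> V)"

text \<open>The common form of the two kinds of trees to be compared: paths in an
  \<open>rtree\<close>, and non-backtracking walks without their starting vertex.\<close>

definition list_graph :: "'a list set \<Rightarrow> 'a list rooted_graph" where
  "list_graph V = \<lparr>verts = V, edges = extension_edges V, root = []\<rparr>"

text \<open>A canonical form for comparing trees of lists up to isomorphism. Since
  \<open>mset_set\<close> sends an infinite set to the empty multiset, it is faithful only for
  finite branching.\<close>

primrec unfold :: "nat \<Rightarrow> 'a list set \<Rightarrow> rtree" where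
  "unfold 0 V = Node {#}"
| "unfold (Suc k) V = Node (image_mset (\<lambda>c. unfold k {p. c # p \<in> V}) (mset_set {c. [c] \<in> V}))"

lemma prefix_closed_Nil: "prefix_closed V \<Longrightarrow> [] \<in> V"
  by (simp add: prefix_closed_def)

lemma prefix_closed_ConsD: "prefix_closed V \<Longrightarrow> c # p \<in> V \<Longrightarrow> [c] \<in> V"
  unfolding prefix_closed_def by (metis append_Cons append_Nil)

lemma prefix_closed_butlast: "prefix_closed V \<Longrightarrow> p \<in> V \<Longrightarrow> butlast p \<in> V"
  unfolding prefix_closed_def by (metis append_butlast_last_id butlast.simps(1))

lemma prefix_closed_subtree:
  assumes "prefix_closed V" "[c] \<in> V"
  shows "prefix_closed {p. c # p \<in> V}"
  using assms unfolding prefix_closed_def by (metis append_Cons mem_Collect_eq)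

text \<open>Adjacency in terms of the parent map \<open>butlast\<close>, so that a map respecting
  parents can be checked vertex by vertex.\<close>

lemma extension_edges_butlast:
  "(p, q) \<in> extension_edges V \<longleftrightarrow>
     p \<in> V \<and> q \<in> V \<and> (q \<noteq> [] \<and> butlast q = p \<or> p \<noteq> [] \<and> butlast p = q)"
  unfolding extension_edges_def
  by auto (metis append_butlast_last_id)+

lemma count_image_mset_set:
  "finite B \<Longrightarrow> count (image_mset F (mset_set B)) s = card {c \<in> B. F c = s}"
proof -
  assume "finite B"
  have "count (image_mset F (mset_set B)) s = size {#y \<in># image_mset F (mset_set B). y = s#}"
    by (simp add: filter_eq_replicate_mset)
  also have "\<dots> = card {c \<in> B. F c = s}"
    using \<open>finite B\<close> by (simp add: filter_mset_image_mset)
  finally show ?thesis .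
qed

text \<open>\<open>graph_of_tree\<close> names a child by its branch and a copy number. Numbering
  each fibre of \<open>F\<close> separately gives the elements of \<open>B\<close> such
  names.\<close>

lemma count_labelling:
  assumes "finite B"
  obtains g where "bij_betw g B {(s, i). i < count (image_mset F (mset_set B)) s}"
    and "\<And>c. c \<in> B \<Longrightarrow> fst (g c) = F c"
proof -
  have "\<exists>e. bij_betw e {c \<in> B. F c = s} {0..<card {c \<in> B. F c = s}}" for s
    using assms by (intro ex_bij_betw_finite_nat) auto
  then obtain e where e: "\<And>s. bij_betw (e s) {c \<in> B. F c = s} {0..<card {c \<in> B. F c = s}}"
    by metis
  define g where "g c = (F c, e (F c) c)" for c
  have "inj_on g B"
    using e unfolding g_def inj_on_def bij_betw_def by auto
  moreover have "g ` B = {(s, i). i < card {c \<in> B. F c = s}}"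
  proof (intro equalityI subsetI)
    fix y assume "y \<in> g ` B"
    then obtain c where "c \<in> B" "y = g c" by blast
    then show "y \<in> {(s, i). i < card {c \<in> B. F c = s}}"
      using e[of "F c"] unfolding g_def bij_betw_def by fastforce
  next
    fix y assume "y \<in> {(s, i). i < card {c \<in> B. F c = s}}"
    then obtain s i where y: "y = (s, i)" "i < card {c \<in> B. F c = s}" by auto
    then have "i \<in> e s ` {c \<in> B. F c = s}"
      using e[of s] unfolding bij_betw_def by auto
    then show "y \<in> g ` B" unfolding g_def y by auto
  qed
  ultimately show thesis
    by (intro that[of g]) (auto simp: bij_betw_def count_image_mset_set[OF assms] g_def)
qed

text \<open>The bijection is required to respect length and parent, which pass directly through the
  recursion on the first step; adjacency follows from them afterwards.\<close>

lemma unfold_path_bijection: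
  assumes "prefix_closed V" "\<And>p. finite {c. p @ [c] \<in> V}"
  shows "\<exists>f. bij_betw f {p \<in> V. length p \<le> k} {p. path_in p (unfold k V)} \<and>
    (\<forall>p \<in> V. length p \<le> k \<longrightarrow> length (f p) = length p \<and> f (butlast p) = butlast (f p))"
  using assms
proof (induction k arbitrary: V)
  case 0
  have "{p \<in> V. length p \<le> 0} = {[]}"
    using 0 by (auto simp: prefix_closed_Nil)
  moreover have "{p. path_in p (unfold 0 V)} = {[]}"
  proof -
    have "path_in p (unfold 0 V) \<longleftrightarrow> p = []" for p by (cases p) auto
    then show ?thesis by auto
  qed
  ultimately show ?case
    by (intro exI[of _ "\<lambda>_. []"]) (auto simp: bij_betw_def)
next
  case (Suc k)
  define B where "B = {c. [c] \<in> V}"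
  define U where "U c = {p. c # p \<in> V}" for c
  have fin: "finite B" using Suc.prems(2)[of "[]"] by (simp add: B_def)
  obtain g where g: "bij_betw g B {(s, i). i < count (image_mset (\<lambda>c. unfold k (U c)) (mset_set B)) s}"
    and g1: "\<And>c. c \<in> B \<Longrightarrow> fst (g c) = unfold k (U c)"
    using count_labelling[OF fin] by blast
  have "\<exists>f. bij_betw f {p \<in> U c. length p \<le> k} {p. path_in p (unfold k (U c))} \<and>
    (\<forall>p \<in> U c. length p \<le> k \<longrightarrow> length (f p) = length p \<and> f (butlast p) = butlast (f p))"
    if "c \<in> B" for c
  proof (rule Suc.IH)
    show "prefix_closed (U c)"
      using prefix_closed_subtree[OF Suc.prems(1)] that by (simp add: U_def B_def)
    show "finite {d. p @ [d] \<in> U c}" for p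
      using Suc.prems(2)[of "c # p"] by (simp add: U_def)
  qed
  from bchoice[OF ballI[OF this]] obtain F where "\<forall>c\<in>B.
      bij_betw (F c) {p \<in> U c. length p \<le> k} {p. path_in p (unfold k (U c))} \<and>
      (\<forall>p \<in> U c. length p \<le> k \<longrightarrow>
        length (F c p) = length p \<and> F c (butlast p) = butlast (F c p))" ..
  then have F: "\<And>c. c \<in> B \<Longrightarrow>
      bij_betw (F c) {p \<in> U c. length p \<le> k} {p. path_in p (unfold k (U c))}"
    and Fl: "\<And>c p. c \<in> B \<Longrightarrow> p \<in> U c \<Longrightarrow> length p \<le> k \<Longrightarrow>
      length (F c p) = length p \<and> F c (butlast p) = butlast (F c p)"
    by simp_all
  \<comment> \<open>\<open>g\<close> names the first step by its branch and copy number;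
    \<open>F c\<close> translates the rest of the path inside that branch.\<close>
  define f where "f p = (case p of [] \<Rightarrow> [] | c # q \<Rightarrow> g c # F c q)" for p
  have f_simps: "f [] = []" "f (c # q) = g c # F c q" for c q by (simp_all add: f_def)
  have Cons_iff: "c # q \<in> V \<longleftrightarrow> c \<in> B \<and> q \<in> U c" for c q
    using prefix_closed_ConsD[OF Suc.prems(1)] by (auto simp: B_def U_def)
  have path_Cons: "path_in (d # q) (unfold (Suc k) V) \<longleftrightarrow> d \<in> g ` B \<and> path_in q (fst d)" for d q
    unfolding bij_betw_imp_surj_on[OF g] by (cases d) (simp add: B_def U_def)
  have "inj_on f {p \<in> V. length p \<le> Suc k}"
  proof (rule inj_onI)
    fix p q assume pq: "p \<in> {p \<in> V. length p \<le> Suc k}" "q \<in> {p \<in> V. length p \<le> Suc k}" "f p = f q"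
    show "p = q"
    proof (cases p)
      case Nil
      with pq show ?thesis by (cases q) (auto simp: f_simps)
    next
      case (Cons c p')
      then obtain d q' where q: "q = d # q'" using pq by (cases q) (auto simp: f_simps)
      have "c = d"
        using pq inj_onD[OF bij_betw_imp_inj_on[OF g], of c d] by (simp add: Cons q f_simps Cons_iff)
      then show ?thesis
        using pq inj_onD[OF bij_betw_imp_inj_on[OF F[of c]], of p' q'] by (simp add: Cons q f_simps Cons_iff)
    qed
  qed
  moreover have "f ` {p \<in> V. length p \<le> Suc k} = {p. path_in p (unfold (Suc k) V)}"
  proof (intro equalityI subsetI)
    fix y assume "y \<in> f ` {p \<in> V. length p \<le> Suc k}"
    then obtain p where p: "p \<in> V" "length p \<le> Suc k" "y = f p" by blast
    show "y \<in> {p. path_in p (unfold (Suc k) V)}"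
    proof (cases p)
      case Nil
      then show ?thesis by (simp add: p f_simps)
    next
      case (Cons c q)
      then have "c \<in> B" "q \<in> U c" "length q \<le> k" using p by (auto simp: Cons_iff)
      then have "path_in (F c q) (unfold k (U c))"
        using bij_betwE[OF F[of c]] by simp
      then show ?thesis
        using g1[of c] \<open>c \<in> B\<close> unfolding p Cons f_simps mem_Collect_eq path_Cons by simp
    qed
  next
    fix y assume y: "y \<in> {p. path_in p (unfold (Suc k) V)}"
    show "y \<in> f ` {p \<in> V. length p \<le> Suc k}"
    proof (cases y)
      case Nil
      then show ?thesis
        using prefix_closed_Nil[OF Suc.prems(1)] by (intro image_eqI[of _ _ "[]"]) (auto simp: f_simps)
    next
      case (Cons d z)
      then obtain c where c: "c \<in> B" "d = g c" "path_in z (unfold k (U c))"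
        using y g1 by (auto simp only: mem_Collect_eq path_Cons)
      then have "z \<in> F c ` {p \<in> U c. length p \<le> k}"
        using bij_betw_imp_surj_on[OF F[of c]] by simp
      then obtain q where "q \<in> U c" "length q \<le> k" "z = F c q" by blast
      then show ?thesis
        using c by (intro image_eqI[of _ _ "c # q"]) (auto simp: Cons f_simps Cons_iff)
    qed
  qed
  moreover have "length (f p) = length p \<and> f (butlast p) = butlast (f p)"
    if "p \<in> V" "length p \<le> Suc k" for p
  proof (cases p)
    case (Cons c q)
    then have "length (F c q) = length q \<and> F c (butlast q) = butlast (F c q)"
      using that by (intro Fl) (auto simp: Cons_iff)
    then show ?thesis by (auto simp: Cons f_simps)
  qed (simp add: f_simps)
  ultimately show ?case unfolding bij_betw_def by blast
qed

text \<open>Preserving length, only \<open>[]\<close> goes to \<open>[]\<close>; with injectivity,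
  commuting with \<open>butlast\<close> then gives adjacency in both directions.\<close>

lemma list_graph_iso_unfold:
  assumes "prefix_closed V" "\<And>p. finite {c. p @ [c] \<in> V}"
  shows "rooted_iso (list_graph {p \<in> V. length p \<le> k}) (graph_of_tree (unfold k V))"
proof -
  let ?V = "{p \<in> V. length p \<le> k}"
  obtain f where f: "bij_betw f ?V {p. path_in p (unfold k V)}"
    and fl: "\<And>p. p \<in> ?V \<Longrightarrow> length (f p) = length p"
    and fb: "\<And>p. p \<in> ?V \<Longrightarrow> f (butlast p) = butlast (f p)"
    using unfold_path_bijection[OF assms, of k] by auto
  have inj: "f p = f q \<longleftrightarrow> p = q" if "p \<in> ?V" "q \<in> ?V" for p q
    using f that unfolding bij_betw_def inj_on_def by blast
  have bl: "butlast p \<in> ?V" if "p \<in> ?V" for p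
    using that prefix_closed_butlast[OF assms(1)] by auto
  have ne: "f p \<noteq> [] \<longleftrightarrow> p \<noteq> []" if "p \<in> ?V" for p
    using fl[OF that] by auto
  have step: "butlast q = p \<longleftrightarrow> butlast (f q) = f p" if "p \<in> ?V" "q \<in> ?V" for p q
    using inj[OF bl[OF that(2)] that(1)] fb[OF that(2)] by auto
  have mem: "path_in (f p) (unfold k V)" if "p \<in> ?V" for p
    using f that unfolding bij_betw_def by blast
  have "f [] = []"
    using fl[of "[]"] prefix_closed_Nil[OF assms(1)] by simp
  moreover have "(u, v) \<in> extension_edges ?V \<longleftrightarrow>
      (f u, f v) \<in> extension_edges {p. path_in p (unfold k V)}" if "u \<in> ?V" "v \<in> ?V" for u v
    unfolding extension_edges_butlast
    using that step[of u v] step[of v u] ne[of u] ne[of v] mem[of u] mem[of v] by auto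
  ultimately show ?thesis
    using f unfolding rooted_iso_def list_graph_def graph_of_tree_def
    by (intro exI[of _ f]) simp
qed

text \<open>The only way out of a branch is through the root, and by injectivity no vertex other
  than the root is sent there. So the image of the branch at \<open>c\<close> stays in one
  branch.\<close>

lemma list_graph_iso_head:
  assumes "prefix_closed V" "inj_on f V" "f [] = []"
    and "\<And>u v. u \<in> V \<Longrightarrow> v \<in> V \<Longrightarrow>
      (u, v) \<in> extension_edges V \<longleftrightarrow> (f u, f v) \<in> extension_edges W"
    and "c # p \<in> V"
  shows "\<exists>q. f (c # p) = hd (f [c]) # q"
  using assms(5)
proof (induction p rule: rev_induct)
  case Nil
  then have "([], [c]) \<in> extension_edges V"
    using assms(1) by (auto simp: extension_edges_def prefix_closed_Nil)
  then have "([], f [c]) \<in> extension_edges W"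
    using assms(3,4) Nil prefix_closed_Nil[OF assms(1)] by metis
  then show ?case by (auto simp: extension_edges_def)
next
  case (snoc d p)
  have V: "c # p \<in> V"
    using prefix_closed_butlast[OF assms(1) snoc.prems] by (simp add: butlast_append)
  then obtain q where q: "f (c # p) = hd (f [c]) # q" using snoc.IH by blast
  have "(c # p, c # p @ [d]) \<in> extension_edges V"
    using V snoc.prems by (auto simp: extension_edges_def)
  then have "(f (c # p), f (c # p @ [d])) \<in> extension_edges W"
    using assms(4) V snoc.prems by metis
  \<comment> \<open>This excludes a step from a child of the root back to the root, the only
    neighbor that would leave the branch.\<close>
  moreover have "f (c # p @ [d]) \<noteq> []"
    using assms(1-3) snoc.prems prefix_closed_Nil[OF assms(1)] unfolding inj_on_def by (metis list.distinct(1))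
  ultimately show ?case
    unfolding extension_edges_def q by (auto simp: Cons_eq_append_conv) (metis)
qed

lemma extension_edges_Cons:
  "(c # p, c # q) \<in> extension_edges V \<longleftrightarrow> (p, q) \<in> extension_edges {p. c # p \<in> V}"
  by (auto simp: extension_edges_def)

text \<open>A rooted isomorphism maps each branch at the root onto a branch at the root, so
  induction on the depth applies to the branches.\<close>

lemma list_graph_iso_imp_unfold_eq:
  assumes "prefix_closed V" "prefix_closed W" "rooted_iso (list_graph V) (list_graph W)"
  shows "unfold k V = unfold k W"
  using assms
proof (induction k arbitrary: V W)
  case 0
  then show ?case by simp
next
  case (Suc k)
  obtain f where f: "bij_betw f V W" "f [] = []"
    and e: "\<And>u v. u \<in> V \<Longrightarrow> v \<in> V \<Longrightarrow>
      (u, v) \<in> extension_edges V \<longleftrightarrow> (f u, f v) \<in> extension_edges W"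
    using Suc.prems(3) unfolding rooted_iso_def list_graph_def by auto
  have inj: "inj_on f V" and im: "f ` V = W" using f by (auto simp: bij_betw_def)
  \<comment> \<open>The induced map on the children of the root, shown below to be a
    bijection.\<close>
  define g where "g c = hd (f [c])" for c
  have hd: "\<exists>q. f (c # p) = g c # q" if "c # p \<in> V" for c p
    unfolding g_def by (rule list_graph_iso_head[OF Suc.prems(1) inj f(2) e that])
  have f1: "f [c] = [g c]" if "[c] \<in> V" for c
  proof -
    have "([], [c]) \<in> extension_edges V"
      using that Suc.prems(1) by (auto simp: extension_edges_def prefix_closed_Nil)
    then have "([], f [c]) \<in> extension_edges W"
      using e f(2) that prefix_closed_Nil[OF Suc.prems(1)] by metis
    then show ?thesis by (auto simp: extension_edges_def g_def)
  qed
  have ginj: "inj_on g {c. [c] \<in> V}"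
  proof (rule inj_onI)
    fix c d assume "c \<in> {c. [c] \<in> V}" "d \<in> {c. [c] \<in> V}" "g c = g d"
    then show "c = d" using f1[of c] f1[of d] inj_onD[OF inj, of "[c]" "[d]"] by simp
  qed
  have surj: "\<exists>q. d # p = f (c # q) \<and> c # q \<in> V \<and> d = g c" if a: "d = g c" "[c] \<in> V" "d # p \<in> W" for c d p
  proof -
    have "d # p \<in> f ` V" using a(3) im by simp
    then obtain u where u: "u \<in> V" "f u = d # p" by (metis imageE)
    then obtain c' q where u': "u = c' # q" using f(2) by (cases u) auto
    have "g c' = d" using hd[of c' q] u u' by auto
    then have "c' = c"
      using ginj that prefix_closed_ConsD[OF Suc.prems(1)] u u' unfolding inj_on_def by auto
    then show ?thesis using u u' a(1) by metis
  qed
  have gim: "g ` {c. [c] \<in> V} = {d. [d] \<in> W}"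
  proof (intro equalityI subsetI)
    fix d assume "d \<in> g ` {c. [c] \<in> V}"
    then show "d \<in> {d. [d] \<in> W}" using f1 im by (auto intro: rev_image_eqI)
  next
    fix d assume "d \<in> {d. [d] \<in> W}"
    then have "[d] \<in> f ` V" using im by simp
    then obtain u where u: "u \<in> V" "f u = [d]" by (metis imageE)
    then obtain c q where u': "u = c # q" using f(2) by (cases u) auto
    have "g c = d" using hd[of c q] u u' by auto
    then show "d \<in> g ` {c. [c] \<in> V}" using prefix_closed_ConsD[OF Suc.prems(1)] u u' by auto
  qed
  have "unfold k {p. c # p \<in> V} = unfold k {p. g c # p \<in> W}" if c: "[c] \<in> V" for c
  proof (rule Suc.IH)
    have gc: "[g c] \<in> W" using gim c by auto
    show "prefix_closed {p. c # p \<in> V}" "prefix_closed {p. g c # p \<in> W}"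
      using prefix_closed_subtree[OF Suc.prems(1) c] prefix_closed_subtree[OF Suc.prems(2) gc] .
    \<comment> \<open>The isomorphism restricted to the branch at \<open>c\<close>, with the first
      steps \<open>c\<close> and \<open>g c\<close> dropped.\<close>
    define f' where "f' p = tl (f (c # p))" for p
    have f': "f (c # p) = g c # f' p" if "c # p \<in> V" for p
      using hd[OF that] by (auto simp: f'_def)
    have "inj_on f' {p. c # p \<in> V}"
    proof (rule inj_onI)
      fix p q assume "p \<in> {p. c # p \<in> V}" "q \<in> {p. c # p \<in> V}" "f' p = f' q"
      then show "p = q" using f'[of p] f'[of q] inj_onD[OF inj, of "c # p" "c # q"] by simp
    qed
    moreover have "f' ` {p. c # p \<in> V} = {p. g c # p \<in> W}"
    proof (intro equalityI subsetI)
      fix q assume "q \<in> f' ` {p. c # p \<in> V}"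
      then obtain p where p: "c # p \<in> V" "q = f' p" by blast
      then have "g c # q = f (c # p)" using f' by simp
      then show "q \<in> {p. g c # p \<in> W}" using p(1) im by blast
    next
      fix q assume "q \<in> {p. g c # p \<in> W}"
      then show "q \<in> f' ` {p. c # p \<in> V}" using surj[OF refl c, of q] f' by auto
    qed
    moreover have "f' [] = []" using f'[of "[]"] f1[OF c] c by simp
    moreover have "(u, v) \<in> extension_edges {p. c # p \<in> V} \<longleftrightarrow>
        (f' u, f' v) \<in> extension_edges {p. g c # p \<in> W}" if "c # u \<in> V" "c # v \<in> V" for u v
      using e[OF that] f'[OF that(1)] f'[OF that(2)] extension_edges_Cons by metis
    ultimately show "rooted_iso (list_graph {p. c # p \<in> V}) (list_graph {p. g c # p \<in> W})"
      unfolding rooted_iso_def list_graph_def by (intro exI[of _ f']) (simp add: bij_betw_def)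
  qed
  \<comment> \<open>If the root has infinitely many children, both multisets are empty.\<close>
  then have "image_mset (\<lambda>c. unfold k {p. c # p \<in> V}) (mset_set {c. [c] \<in> V}) =
      image_mset (\<lambda>c. unfold k {p. g c # p \<in> W}) (mset_set {c. [c] \<in> V})"
    by (cases "finite {c. [c] \<in> V}") (auto intro!: image_mset_cong)
  also have "\<dots> = image_mset (\<lambda>d. unfold k {p. d # p \<in> W}) (mset_set {d. [d] \<in> W})"
    unfolding gim[symmetric] image_mset_mset_set[OF ginj, symmetric] by (simp add: multiset.map_comp comp_def)
  finally show ?case by simp
qed

section \<open>Isomorphisms of rooted graphs and balls in trees\<close>

text \<open>A \<open>rooted_graph\<close> need not contain its root; the second assumption lets the
  inverse map send the root back.\<close>

lemma rooted_iso_sym: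
  assumes "rooted_iso G H" "root G \<in> verts G"
  shows "rooted_iso H G"
proof -
  obtain f where f: "bij_betw f (verts G) (verts H)" "f (root G) = root H"
    and e: "\<And>u v. u \<in> verts G \<Longrightarrow> v \<in> verts G \<Longrightarrow> (u, v) \<in> edges G \<longleftrightarrow> (f u, f v) \<in> edges H"
    using assms(1) by (auto simp: rooted_iso_def)
  let ?g = "inv_into (verts G) f"
  have "bij_betw ?g (verts H) (verts G)"
    by (rule bij_betw_inv_into[OF f(1)])
  moreover have "?g (root H) = root G"
    using bij_betw_inv_into_left[OF f(1) assms(2)] f(2) by simp
  moreover have "(u, v) \<in> edges H \<longleftrightarrow> (?g u, ?g v) \<in> edges G"
    if "u \<in> verts H" "v \<in> verts H" for u v
  proof -
    have "f (?g u) = u" "f (?g v) = v"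
      using that bij_betw_inv_into_right[OF f(1)] by auto
    moreover have "?g u \<in> verts G" "?g v \<in> verts G"
      using that \<open>bij_betw ?g (verts H) (verts G)\<close> by (auto simp: bij_betw_def)
    ultimately show ?thesis using e by metis
  qed
  ultimately show ?thesis unfolding rooted_iso_def by blast
qed

lemma rooted_iso_trans: "rooted_iso G H \<Longrightarrow> rooted_iso H K \<Longrightarrow> rooted_iso G K"
  unfolding rooted_iso_def
proof (elim exE conjE)
  fix f g
  assume f: "bij_betw f (verts G) (verts H)" "f (root G) = root H"
    "\<forall>u\<in>verts G. \<forall>v\<in>verts G. (u, v) \<in> edges G \<longleftrightarrow> (f u, f v) \<in> edges H"
    and g: "bij_betw g (verts H) (verts K)" "g (root H) = root K"
    "\<forall>u\<in>verts H. \<forall>v\<in>verts H. (u, v) \<in> edges H \<longleftrightarrow> (g u, g v) \<in> edges K"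
  have "f u \<in> verts H" if "u \<in> verts G" for u using f(1) that by (auto simp: bij_betw_def)
  then show "\<exists>f. bij_betw f (verts G) (verts K) \<and> f (root G) = root K \<and>
     (\<forall>u\<in>verts G. \<forall>v\<in>verts G. (u, v) \<in> edges G \<longleftrightarrow> (f u, f v) \<in> edges K)"
    using f g bij_betw_trans[OF f(1) g(1)] by (intro exI[of _ "g \<circ> f"]) simp
qed

lemma depth_le_Suc_iff: "depth (Node M) \<le> Suc k \<longleftrightarrow> (\<forall>s \<in># M. depth s \<le> k)"
  by auto

lemma tree_ball_depth: "depth t \<le> k \<Longrightarrow> tree_ball k t = t"
proof (induction k arbitrary: t)
  case 0
  obtain M where t: "t = Node M" by (cases t)
  have "finite (insert 0 (Suc ` depth ` set_mset M))" by simp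
  from Max_ge[OF this] have "s \<notin># M" for s
    using 0 unfolding t by (metis depth.simps image_eqI insertI2 not_less_eq_eq set_image_mset zero_le le_trans)
  then have "M = {#}" by (meson multiset_nonemptyE)
  then show ?case by (simp add: t)
next
  case (Suc k)
  obtain M where t: "t = Node M" by (cases t)
  have "image_mset (tree_ball k) M = image_mset id M"
    using Suc.IH Suc.prems unfolding t depth_le_Suc_iff by (intro image_mset_cong) simp
  then show ?case by (simp add: t)
qed

lemma tree_ball_tree_ball: "j \<le> k \<Longrightarrow> tree_ball j (tree_ball k t) = tree_ball j t"
proof (induction j arbitrary: k t)
  case 0
  then show ?case by simp
next
  case (Suc j)
  then show ?case by (cases k) (simp_all add: multiset.map_comp comp_def)
qed

lemma prefix_closed_paths: "prefix_closed {p. path_in p t}"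
proof -
  have "path_in (p @ q) t \<Longrightarrow> path_in p t" for p q
    by (induction p arbitrary: t) auto
  then show ?thesis by (auto simp: prefix_closed_def)
qed

text \<open>\<open>unfold\<close> recovers a tree from its concrete graph up to truncation:
  forgetting the copy numbers in the pairs \<open>(s, i)\<close> returns each branch with its
  multiplicity. Hence isomorphic concrete graphs come from equal truncations.\<close>

lemma unfold_paths: "unfold k {p. path_in p t} = tree_ball k t"
proof (induction k arbitrary: t)
  case 0
  then show ?case by simp
next
  case (Suc k)
  let ?M = "children t"
  have fin: "finite {(s, i). i < count ?M s}"
  proof -
    have "{(s, i). i < count ?M s} = (SIGMA s:set_mset ?M. {..<count ?M s})"
      by (auto simp flip: count_greater_zero_iff)
    then show ?thesis by simp
  qed
  have "image_mset (\<lambda>c. unfold k {p. c # p \<in> {p. path_in p t}}) (mset_set {c. [c] \<in> {p. path_in p t}}) =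
      image_mset (\<lambda>c. tree_ball k (fst c)) (mset_set {(s, i). i < count ?M s})"
    using fin by (auto simp: Suc.IH case_prod_unfold intro!: image_mset_cong)
  also have "\<dots> = image_mset (tree_ball k) (image_mset fst (mset_set {(s, i). i < count ?M s}))"
    by (simp add: multiset.map_comp comp_def)
  also have "image_mset fst (mset_set {(s, i). i < count ?M s}) = ?M"
  proof (rule multiset_eqI)
    fix s
    have "{c \<in> {(s, i). i < count ?M s}. fst c = s} = Pair s ` {..<count ?M s}" by auto
    moreover have "card (Pair s ` {..<count ?M s}) = count ?M s"
      by (subst card_image) (auto simp: inj_on_def)
    ultimately show "count (image_mset fst (mset_set {(s, i). i < count ?M s})) s = count ?M s"
      by (simp only: count_image_mset_set[OF fin])
  qed
  finally show ?case by simp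
qed

section \<open>Universal covers\<close>

text \<open>The walks that have just entered \<open>v\<close> from \<open>u\<close>, as a tree of
  depth at most \<open>k\<close> rooted at \<open>v\<close>. In a realization these trees are the
  components of the edge types.\<close>

primrec branch :: "nat \<Rightarrow> 'v rel \<Rightarrow> 'v \<Rightarrow> 'v \<Rightarrow> rtree" where
  "branch 0 G u v = Node {#}"
| "branch (Suc k) G u v = Node (image_mset (branch k G v) (mset_set (G `` {v} - {u})))"

text \<open>Note the shift: \<open>cover_tree k\<close> is the neighborhood of depth \<open>k + 1\<close>.\<close>

definition cover_tree :: "nat \<Rightarrow> 'v rel \<Rightarrow> 'v \<Rightarrow> rtree" where
  "cover_tree k G x = Node (image_mset (branch k G x) (mset_set (G `` {x})))"

lemma nb_walks_Cons2:
  "u # v # w \<in> nb_walks G u \<longleftrightarrow>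
     (u, v) \<in> G \<and> v # w \<in> nb_walks G v \<and> (w \<noteq> [] \<longrightarrow> u \<noteq> hd w)"
proof -
  have "(\<forall>k. k + 2 < length (u # v # w) \<longrightarrow> (u # v # w) ! k \<noteq> (u # v # w) ! (k + 2)) \<longleftrightarrow>
      (\<forall>k. k + 2 < length (v # w) \<longrightarrow> (v # w) ! k \<noteq> (v # w) ! (k + 2)) \<and> (w \<noteq> [] \<longrightarrow> u \<noteq> hd w)"
    (is "(\<forall>k. ?P k) \<longleftrightarrow> (\<forall>k. ?Q k) \<and> ?R")
  proof -
    have "(\<forall>k. ?P k) \<longleftrightarrow> ?P 0 \<and> (\<forall>k. ?P (Suc k))" by (metis not0_implies_Suc)
    moreover have "?P 0 \<longleftrightarrow> ?R" by (cases w) auto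
    moreover have "?P (Suc k) \<longleftrightarrow> ?Q k" for k by simp
    ultimately show ?thesis by blast
  qed
  then show ?thesis by (auto simp: nb_walks_def)
qed

lemma nb_walks_single: "[x] \<in> nb_walks G x"
  by (simp add: nb_walks_def)

text \<open>The previous vertex \<open>u\<close> restricts only the next step, which is why its
  removal from the neighbors of \<open>v\<close> captures the non-backtracking condition.\<close>

lemma unfold_nb_walks_branch:
  "(u, v) \<in> G \<Longrightarrow> unfold k {p. u # v # p \<in> nb_walks G u} = branch k G u v"
proof (induction k arbitrary: u v)
  case 0
  then show ?case by simp
next
  case (Suc k)
  have "{c. [c] \<in> {p. u # v # p \<in> nb_walks G u}} = G `` {v} - {u}"
    using Suc.prems by (auto simp: nb_walks_Cons2 nb_walks_single)
  moreover have "image_mset (\<lambda>c. unfold k {p. c # p \<in> {p. u # v # p \<in> nb_walks G u}}) (mset_set (G `` {v} - {u}))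
      = image_mset (branch k G v) (mset_set (G `` {v} - {u}))"
  proof (cases "finite (G `` {v} - {u})")
    case True
    \<comment> \<open>Once the step to \<open>c\<close> is made, \<open>u\<close> no longer
      constrains the walk.\<close>
    have "{p. c # p \<in> {p. u # v # p \<in> nb_walks G u}} = {p. v # c # p \<in> nb_walks G v}"
      if "c \<in> G `` {v} - {u}" for c
      using that Suc.prems by (auto simp: nb_walks_Cons2)
    then show ?thesis using True Suc.IH by (intro image_mset_cong) auto
  qed simp
  ultimately show ?case by simp
qed

lemma unfold_nb_walks: "unfold (Suc k) {p. x # p \<in> nb_walks G x} = cover_tree k G x"
proof -
  have "{c. [c] \<in> {p. x # p \<in> nb_walks G x}} = G `` {x}"
    by (auto simp: nb_walks_Cons2 nb_walks_single)
  moreover have "image_mset (\<lambda>c. unfold k {p. c # p \<in> {p. x # p \<in> nb_walks G x}}) (mset_set (G `` {x}))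
      = image_mset (branch k G x) (mset_set (G `` {x}))"
    by (cases "finite (G `` {x})") (auto intro!: image_mset_cong simp: unfold_nb_walks_branch)
  ultimately show ?thesis by (simp add: cover_tree_def)
qed

lemma nb_walks_append: "w @ w' \<in> nb_walks G x \<Longrightarrow> w \<noteq> [] \<Longrightarrow> w \<in> nb_walks G x"
  unfolding nb_walks_def
  by (auto simp: successively_append_iff nth_append split: if_splits)

lemma prefix_closed_nb_walks: "prefix_closed {p. x # p \<in> nb_walks G x}"
  unfolding prefix_closed_def
  using nb_walks_append[of "x # p" q G x for p q] by (auto simp: nb_walks_single)

lemma nb_walks_last_edge: "w @ [c] \<in> nb_walks G x \<Longrightarrow> w \<noteq> [] \<Longrightarrow> (last w, c) \<in> G"
  by (auto simp: nb_walks_def successively_append_iff)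

lemma extension_edges_relpow_length:
  "(p, q) \<in> extension_edges V ^^ j \<Longrightarrow> length q \<le> length p + j"
proof (induction j arbitrary: q)
  case (Suc j)
  then show ?case by (fastforce simp: extension_edges_def)
qed simp

text \<open>The distance from the root is the number of steps of the walk: an adjacency changes the
  length by one, and a walk is reached through its prefixes. The isomorphism puts \<open>x\<close>
  back in front.\<close>

lemma universal_cover_ball_iso:
  "rooted_iso (list_graph {p \<in> {p. x # p \<in> nb_walks G x}. length p \<le> k}) (graph_ball k (universal_cover G x))"
proof -
  let ?V = "{p \<in> {p. x # p \<in> nb_walks G x}. length p \<le> k}"
  let ?N = "nb_walks G x"
  have reach: "([x], x # p) \<in> extension_edges ?N ^^ length p" if "x # p \<in> ?N" for p
    using that
  proof (induction p rule: rev_induct)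
    case (snoc c p)
    then have "x # p \<in> ?N" using nb_walks_append[of "x # p" "[c]"] by simp
    then show ?case using snoc by (auto simp: extension_edges_def)
  qed simp
  have mem: "w \<in> ?N \<Longrightarrow> \<exists>p. w = x # p" for w by (cases w) (auto simp: nb_walks_def)
  have ball: "{w \<in> ?N. \<exists>j\<le>k. ([x], w) \<in> extension_edges ?N ^^ j} = (#) x ` ?V"
  proof (intro equalityI subsetI)
    fix w assume "w \<in> {w \<in> ?N. \<exists>j\<le>k. ([x], w) \<in> extension_edges ?N ^^ j}"
    then obtain j where w: "w \<in> ?N" "j \<le> k" "([x], w) \<in> extension_edges ?N ^^ j" by blast
    then obtain p where "w = x # p" using mem by blast
    then show "w \<in> (#) x ` ?V" using w extension_edges_relpow_length[OF w(3)] by auto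
  next
    fix w assume "w \<in> (#) x ` ?V"
    then show "w \<in> {w \<in> ?N. \<exists>j\<le>k. ([x], w) \<in> extension_edges ?N ^^ j}" using reach by blast
  qed
  have "graph_ball k (universal_cover G x) =
      \<lparr>verts = (#) x ` ?V, edges = extension_edges ?N \<inter> (#) x ` ?V \<times> (#) x ` ?V, root = [x]\<rparr>"
    unfolding graph_ball_def universal_cover_def Let_def by (simp only: ball rooted_graph.simps)
  then show ?thesis
    unfolding rooted_iso_def list_graph_def
    by (intro exI[of _ "(#) x"]) (auto simp: bij_betw_def extension_edges_def)
qed

text \<open>Turns isomorphism of concrete graphs into equality of trees: \<open>unfold\<close> is
  invariant under isomorphism, and on both sides it returns the tree in question. Finiteness of
  \<open>G\<close> gives finite branching.\<close>

lemma universal_cover_ball_iso_iff: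
  assumes "finite G" "depth t \<le> Suc k"
  shows "rooted_iso (graph_ball (Suc k) (universal_cover G x)) (graph_of_tree t) \<longleftrightarrow> t = cover_tree k G x"
proof -
  let ?N = "{p. x # p \<in> nb_walks G x}"
  let ?V = "{p \<in> ?N. length p \<le> Suc k}"
  have pc: "prefix_closed ?N" by (rule prefix_closed_nb_walks)
  have pcV: "prefix_closed ?V"
    using pc unfolding prefix_closed_def by auto
  have fin: "finite {c. p @ [c] \<in> ?N}" for p
  proof (rule finite_subset)
    show "{c. p @ [c] \<in> ?N} \<subseteq> snd ` G"
      using nb_walks_last_edge[of "x # p"] by (force simp: image_iff)
  qed (use assms in simp)
  have iso: "rooted_iso (list_graph ?V) (graph_of_tree (cover_tree k G x))"
    using list_graph_iso_unfold[OF pc fin, of "Suc k"] unfolding unfold_nb_walks .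
  have tree: "graph_of_tree s = list_graph {p. path_in p s}" for s
    by (simp add: graph_of_tree_def list_graph_def)
  have ball: "rooted_iso (list_graph ?V) (graph_ball (Suc k) (universal_cover G x))"
    by (rule universal_cover_ball_iso)
  show ?thesis
  proof
    assume "rooted_iso (graph_ball (Suc k) (universal_cover G x)) (graph_of_tree t)"
    from rooted_iso_trans[OF ball this] have "unfold (Suc k) ?V = tree_ball (Suc k) t"
      using list_graph_iso_imp_unfold_eq[OF pcV prefix_closed_paths] unfolding tree unfold_paths by blast
    moreover have "unfold (Suc k) ?V = unfold (Suc k) ?N"
    proof -
      \<comment> \<open>Cutting off lists longer than \<open>j\<close> does not affect what
        \<open>unfold j\<close> reads.\<close>
      have "unfold j {p \<in> V. length p \<le> j} = unfold j V" for j and V :: "'a list set"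
      proof (induction j arbitrary: V)
        case (Suc j)
        have "unfold j {p. c # p \<in> V \<and> length p \<le> j} = unfold j {p. c # p \<in> V}" for c
          using Suc[of "{p. c # p \<in> V}"] by simp
        then show ?case by simp
      qed simp
      then show ?thesis .
    qed
    ultimately show "t = cover_tree k G x"
      using tree_ball_depth[OF assms(2)] by (simp only: unfold_nb_walks)
  next
    assume t: "t = cover_tree k G x"
    have "root (list_graph ?V) \<in> verts (list_graph ?V)"
      by (simp add: list_graph_def nb_walks_single)
    then show "rooted_iso (graph_ball (Suc k) (universal_cover G x)) (graph_of_tree t)"
      unfolding t using rooted_iso_trans[OF rooted_iso_sym[OF ball] iso] by blast
  qed
qed

lemma tree_ball_branch: "j \<le> k \<Longrightarrow> tree_ball j (branch k G u v) = branch j G u v"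
proof (induction j arbitrary: k u v)
  case 0
  then show ?case by simp
next
  case (Suc j)
  then obtain k' where k: "k = Suc k'" by (cases k) auto
  have "image_mset (\<lambda>w. tree_ball j (branch k' G v w)) M = image_mset (branch j G v) M" for M
    using Suc k by (intro image_mset_cong) auto
  then show ?case by (simp add: k multiset.map_comp comp_def)
qed

section \<open>Edge types\<close>

text \<open>The type contains the whole branch \<open>s\<close> as its second component, so only the
  copies of \<open>s\<close> have it. If \<open>s\<close> is not a branch of \<open>t\<close>, both
  sides are 0.\<close>

lemma type_degree_edge_type: "type_degree h (edge_type h t s) t = count (children t) s"
proof -
  have "{#s' \<in># children t. edge_type h t s' = edge_type h t s#} = {#s' \<in># children t. s' = s#}"
    by (intro filter_mset_cong) (auto simp: edge_type_def)
  then show ?thesis by (simp add: type_degree_def filter_eq_replicate_mset)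
qed

lemma type_degree_pos:
  assumes "type_degree h \<tau> t > 0"
  obtains s where "s \<in># children t" "edge_type h t s = \<tau>"
proof -
  have "{#s \<in># children t. edge_type h t s = \<tau>#} \<noteq> {#}"
    using assms unfolding type_degree_def by (metis size_empty less_irrefl)
  then obtain s where "s \<in># {#s \<in># children t. edge_type h t s = \<tau>#}" by blast
  then show thesis using that by auto
qed

text \<open>Restores the removed branch to the truncated remainder \<open>r\<close>. As
  \<open>r\<close> keeps everything up to radius \<open>m\<close>, its ball of radius
  \<open>Suc k\<close> is intact for \<open>k < m\<close>.\<close>

lemma tree_ball_edge_type:
  assumes "s \<in># children t" "edge_type (Suc m) t s = (r, s)" "k < m"
  shows "children (tree_ball (Suc k) t) = add_mset (tree_ball k s) (children (tree_ball (Suc k) r))"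
proof -
  have r: "r = tree_ball m (Node (children t - {#s#}))"
    using assms(2) by (simp add: edge_type_def)
  have "tree_ball (Suc k) r = tree_ball (Suc k) (Node (children t - {#s#}))"
    unfolding r using assms(3) by (intro tree_ball_tree_ball) simp
  moreover have "children t = add_mset s (children t - {#s#})" using assms(1) by simp
  ultimately show ?thesis by simp (metis image_mset_add_mset)
qed

lemma edge_type_depth:
  assumes "depth t \<le> Suc m" "s \<in># children t" "edge_type (Suc m) t s = (r, s)"
  shows "tree_ball m r = r" "tree_ball m s = s"
proof -
  show "tree_ball m r = r"
    using assms(3) by (auto simp: edge_type_def tree_ball_tree_ball)
  obtain M where "t = Node M" by (cases t)
  then have "depth s \<le> m" using assms(1,2) by (simp only: depth_le_Suc_iff rtree.sel)
  then show "tree_ball m s = s" by (rule tree_ball_depth)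
qed

text \<open>By induction on the radius, cancelling at each step the branch along the edge, whose ball of
  smaller radius is already known.\<close>

lemma edge_type_unique:
  assumes "depth t \<le> Suc m" "depth u \<le> Suc m"
    and "s \<in># children t" "edge_type (Suc m) t s = (r, s)"
    and "r \<in># children u" "edge_type (Suc m) u r = (s, r)"
    and "s' \<in># children t" "edge_type (Suc m) t s' = (r', s')"
    and "r' \<in># children u" "edge_type (Suc m) u r' = (s', r')"
  shows "r = r' \<and> s = s'"
proof -
  have "k \<le> m \<Longrightarrow> tree_ball k r = tree_ball k r' \<and> tree_ball k s = tree_ball k s'" for k
  proof (induction k)
    case (Suc k)
    then have "tree_ball k r = tree_ball k r'" "tree_ball k s = tree_ball k s'" "k < m" by auto
    then have "children (tree_ball (Suc k) r) = children (tree_ball (Suc k) r')"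
        "children (tree_ball (Suc k) s) = children (tree_ball (Suc k) s')"
      using tree_ball_edge_type[OF assms(3,4)] tree_ball_edge_type[OF assms(7,8)]
        tree_ball_edge_type[OF assms(5,6)] tree_ball_edge_type[OF assms(9,10)]
      by (metis add_mset_add_mset_same_iff)+
    then show ?case by (metis rtree.expand)
  qed simp
  \<comment> \<open>Radius \<open>m\<close> suffices, since each component of a type is its own ball
    of radius \<open>m\<close>.\<close>
  from this[of m] show ?thesis
    using edge_type_depth[OF assms(1,3,4)] edge_type_depth[OF assms(1,7,8)] by simp
qed

text \<open>Without the branch at \<open>y\<close>, there remain the walks from \<open>x\<close>
  whose first step avoids \<open>y\<close>, that is, those continuing the arc from \<open>y\<close>
  to \<open>x\<close>.\<close>

lemma edge_type_cover_tree:
  assumes "finite G" "sym G" "(x, y) \<in> G"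
  shows "edge_type (Suc m) (cover_tree m G x) (branch m G x y) = (branch m G y x, branch m G x y)"
proof -
  have fin: "finite (G `` {x})" using assms(1) by (rule finite_Image)
  have yx: "y \<in> G `` {x}" using assms(3) by simp
  have "image_mset (branch m G x) (mset_set (G `` {x})) - {#branch m G x y#} =
      image_mset (branch m G x) (mset_set (G `` {x} - {y}))"
    using mset_set.remove[OF fin yx] by simp
  moreover have "tree_ball m (Node (image_mset (branch m G x) (mset_set (G `` {x} - {y})))) = branch m G y x"
  \<comment> \<open>For \<open>m = 0\<close> both sides are a single vertex; for
    \<open>m = Suc k\<close> the truncation cuts the branches at \<open>x\<close> from depth
    \<open>m\<close> to depth \<open>k\<close>.\<close>
  proof (cases m)
    case (Suc k)
    then show ?thesis
      by (simp add: multiset.map_comp comp_def tree_ball_branch del: branch.simps(2))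
        (simp add: tree_ball_branch)
  qed simp
  ultimately show ?thesis by (simp add: edge_type_def cover_tree_def)
qed

lemma type_degree_cover_tree:
  assumes "finite G" "sym G"
  shows "type_degree (Suc m) (r, s) (cover_tree m G x) =
    card {y. (x, y) \<in> G \<and> branch m G y x = r \<and> branch m G x y = s}"
proof -
  have fin: "finite (G `` {x})" using assms(1) by (rule finite_Image)
  have "type_degree (Suc m) (r, s) (cover_tree m G x) =
      size {#y \<in># mset_set (G `` {x}). edge_type (Suc m) (cover_tree m G x) (branch m G x y) = (r, s)#}"
    unfolding type_degree_def
    by (subst (2) cover_tree_def) (simp add: filter_mset_image_mset)
  also have "\<dots> = card {y \<in> G `` {x}. edge_type (Suc m) (cover_tree m G x) (branch m G x y) = (r, s)}"
    using fin by simp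
  also have "{y \<in> G `` {x}. edge_type (Suc m) (cover_tree m G x) (branch m G x y) = (r, s)} =
      {y. (x, y) \<in> G \<and> branch m G y x = r \<and> branch m G x y = s}"
    using edge_type_cover_tree[OF assms] by auto
  finally show ?thesis .
qed

section \<open>Necessity: degrees by type in a realization\<close>

lemma finite_simple_graph: "simple_graph n G \<Longrightarrow> finite G"
  unfolding simple_graph_def by (meson finite_SigmaI finite_atLeastAtMost finite_subset)

text \<open>From here on realizability is a system of equations between trees, and graph
  isomorphisms no longer appear.\<close>

lemma graphical_nbhd_iff_cover_tree:
  assumes "\<And>i. i \<in> {1..n} \<Longrightarrow> depth (t i) \<le> Suc m"
  shows "graphical_nbhd (Suc m) n t \<longleftrightarrow>
    (\<exists>G. simple_graph n G \<and> (\<forall>i\<in>{1..n}. t i = cover_tree m G i))"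
  unfolding graphical_nbhd_def
  using universal_cover_ball_iso_iff[OF finite_simple_graph assms] by blast

text \<open>Sort the arcs of \<open>G\<close> by type. Reversing an arc swaps its type, so
  \<open>D r r\<close> is symmetric and the in-degrees of \<open>D r s\<close> are the out-degrees
  of \<open>D s r\<close>.\<close>

lemma cover_tree_type_degrees:
  assumes "simple_graph n G" "\<And>i. i \<in> {1..n} \<Longrightarrow> t i = cover_tree m G i"
  shows "graphical_seq n (\<lambda>i. type_degree (Suc m) (r, r) (t i))"
    and "digraphical_seq n (\<lambda>i. type_degree (Suc m) (r, s) (t i)) (\<lambda>i. type_degree (Suc m) (s, r) (t i))"
proof -
  have G: "finite G" "sym G" "irrefl G" "G \<subseteq> {1..n} \<times> {1..n}"
    using assms(1) finite_simple_graph by (auto simp: simple_graph_def)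
  define D where "D r s = {(x, y) \<in> G. branch m G y x = r \<and> branch m G x y = s}" for r s
  have conv: "(D r s)\<inverse> = D s r" for r s
    using G(2) by (auto simp: D_def sym_def)
  have deg: "card (D r s `` {i}) = type_degree (Suc m) (r, s) (t i)" if "i \<in> {1..n}" for r s i
  proof -
    have "D r s `` {i} = {y. (i, y) \<in> G \<and> branch m G y i = r \<and> branch m G i y = s}"
      by (auto simp: D_def)
    then show ?thesis using type_degree_cover_tree[OF G(1,2)] assms(2)[OF that] by simp
  qed
  have D: "D r s \<subseteq> {1..n} \<times> {1..n}" "irrefl (D r s)" for r s
    using G(3,4) by (auto simp: D_def irrefl_def)
  have "sym (D r r)" using conv[of r r] by (simp add: sym_conv_converse_eq)
  then show "graphical_seq n (\<lambda>i. type_degree (Suc m) (r, r) (t i))"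
    unfolding graphical_seq_def simple_graph_def using D deg by (intro exI[of _ "D r r"]) simp
  show "digraphical_seq n (\<lambda>i. type_degree (Suc m) (r, s) (t i)) (\<lambda>i. type_degree (Suc m) (s, r) (t i))"
    unfolding digraphical_seq_def simple_digraph_def using D deg conv by (intro exI[of _ "D r s"]) simp
qed

section \<open>Sufficiency: gluing the graphs of all types\<close>

text \<open>Puts the diagonal graphs, the digraphs for \<open>A\<close> and their reversals into one
  family indexed by all pairs, so that the gluing needs no case distinction.\<close>

lemma type_graphs:
  assumes "orientation (types h n t) A"
    and diag: "\<forall>\<tau> \<in> diagonal_types h n t. graphical_seq n (\<lambda>i. type_degree h \<tau> (t i))"
    and off: "\<forall>\<tau> \<in> A. digraphical_seq n (\<lambda>i. type_degree h \<tau> (t i))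
                             (\<lambda>i. type_degree h (prod.swap \<tau>) (t i))"
  obtains E where "\<And>\<tau>. simple_digraph n (E \<tau>)" "\<And>\<tau>. E (prod.swap \<tau>) = (E \<tau>)\<inverse>"
    "\<And>\<tau> i. i \<in> {1..n} \<Longrightarrow> card (E \<tau> `` {i}) = type_degree h \<tau> (t i)"
proof -
  let ?T = "types h n t" and ?\<Delta> = "diagonal_types h n t"
  obtain G where G: "\<And>\<tau>. \<tau> \<in> ?\<Delta> \<Longrightarrow> simple_graph n (G \<tau>) \<and>
      (\<forall>i\<in>{1..n}. card (G \<tau> `` {i}) = type_degree h \<tau> (t i))"
    using diag unfolding graphical_seq_def by metis
  obtain D where D: "\<And>\<tau>. \<tau> \<in> A \<Longrightarrow> simple_digraph n (D \<tau>) \<and>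
      (\<forall>i\<in>{1..n}. card (D \<tau> `` {i}) = type_degree h \<tau> (t i) \<and>
        card ((D \<tau>)\<inverse> `` {i}) = type_degree h (prod.swap \<tau>) (t i))"
    using off unfolding digraphical_seq_def by metis
  have A: "r \<noteq> s \<and> (s, r) \<notin> A" if "(r, s) \<in> A" for r s
    using assms(1) that unfolding orientation_def by fast
  have \<Delta>: "r = s" if "(r, s) \<in> ?\<Delta>" for r s
    using that by (auto simp: diagonal_types_def)
  have cover: "(r, s) \<in> ?\<Delta> \<or> (r, s) \<in> A \<or> (s, r) \<in> A" if "(r, s) \<in> ?T" for r s
    using assms(1) that unfolding orientation_def diagonal_types_def by fast
  \<comment> \<open>The cases are consistent under swapping because \<open>A\<close> never contains
    both a pair and its opposite; pairs outside all cases get no arcs.\<close>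
  define E where "E \<tau> = (if \<tau> \<in> ?\<Delta> then G \<tau> else if \<tau> \<in> A then D \<tau>
    else if prod.swap \<tau> \<in> A then (D (prod.swap \<tau>))\<inverse> else {})" for \<tau>
  have "simple_digraph n (E \<tau>)" for \<tau>
  proof -
    have "simple_digraph n R \<Longrightarrow> simple_digraph n (R\<inverse>)" for R
      by (auto simp: simple_digraph_def irrefl_def)
    moreover have "simple_graph n R \<Longrightarrow> simple_digraph n R" for R
      by (auto simp: simple_digraph_def simple_graph_def)
    moreover have "simple_digraph n {}" by (simp add: simple_digraph_def irrefl_def)
    ultimately show ?thesis using G D unfolding E_def by auto
  qed
  moreover have "E (prod.swap \<tau>) = (E \<tau>)\<inverse>" for \<tau>
  proof (cases \<tau>)
    case (Pair r s)
    show ?thesis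
    proof (cases "r = s")
      case True
      have "(r, r) \<in> ?\<Delta> \<Longrightarrow> (G (r, r))\<inverse> = G (r, r)"
        using G[of "(r, r)"] by (simp add: simple_graph_def sym_conv_converse_eq)
      then show ?thesis using A[of r r] by (auto simp: Pair True E_def)
    next
      case False
      then show ?thesis using A[of r s] A[of s r] \<Delta>[of r s] \<Delta>[of s r] by (auto simp: Pair E_def)
    qed
  qed
  moreover have "card (E \<tau> `` {i}) = type_degree h \<tau> (t i)" if i: "i \<in> {1..n}" for \<tau> i
  proof (cases "\<tau> \<in> ?\<Delta> \<or> \<tau> \<in> A \<or> prod.swap \<tau> \<in> A")
    case True
    then show ?thesis using G[of \<tau>] D[of \<tau>] D[of "prod.swap \<tau>"] i by (auto simp: E_def)
  next
    case False
    \<comment> \<open>By \<open>cover\<close> such a pair is not a type of any root edge, so its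
      degree is 0, as in the empty digraph.\<close>
    then have "\<tau> \<notin> ?T" using cover by (cases \<tau>) auto
    then have "\<not> type_degree h \<tau> (t i) > 0"
      using type_degree_pos[of h \<tau> "t i"] i unfolding types_def by blast
    then show ?thesis using False by (simp add: E_def)
  qed
  ultimately show thesis by (rule that)
qed

text \<open>In the union each arc has exactly one type. The types prescribe a branch of
  \<open>t i\<close> for each neighbor of \<open>i\<close>, and induction on the radius shows that
  the walks of the union produce just these branches.\<close>

lemma type_graphs_imp_graphical_nbhd:
  assumes depth: "\<And>i. i \<in> {1..n} \<Longrightarrow> depth (t i) \<le> Suc m"
    and E: "\<And>\<tau>. simple_digraph n (E \<tau>)" "\<And>\<tau>. E (prod.swap \<tau>) = (E \<tau>)\<inverse>"
    and deg: "\<And>\<tau> i. i \<in> {1..n} \<Longrightarrow> card (E \<tau> `` {i}) = type_degree (Suc m) \<tau> (t i)"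
  shows "graphical_nbhd (Suc m) n t"
proof -
  define G where "G = (\<Union>\<tau>. E \<tau>)"
  have sub: "E \<tau> \<subseteq> {1..n} \<times> {1..n}" for \<tau> using E(1) by (auto simp: simple_digraph_def)
  have mem: "i \<in> {1..n} \<and> j \<in> {1..n}" if "(i, j) \<in> E \<tau>" for i j \<tau>
    using sub[of \<tau>] that by blast
  have G: "simple_graph n G"
  proof -
    have "irrefl G" using E(1) by (auto simp: simple_digraph_def irrefl_def G_def)
    moreover have "sym G"
    proof (rule symI)
      fix i j assume "(i, j) \<in> G"
      then obtain \<tau> where "(i, j) \<in> E \<tau>" by (auto simp: G_def)
      then have "(j, i) \<in> E (prod.swap \<tau>)" unfolding E(2) by simp
      then show "(j, i) \<in> G" unfolding G_def by blast
    qed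
    ultimately show ?thesis using sub by (auto simp: simple_graph_def G_def)
  qed
  have fin: "finite (E \<tau> `` {i})" for \<tau> i
  proof (rule finite_subset)
    show "E \<tau> `` {i} \<subseteq> {1..n}" using sub[of \<tau>] by blast
  qed simp
  \<comment> \<open>An arc of type \<open>(r, s)\<close> leaving \<open>i\<close> makes the degree
    positive, so \<open>t i\<close> really has a root edge of this type.\<close>
  have child: "s \<in># children (t i) \<and> edge_type (Suc m) (t i) s = (r, s)" if "(i, j) \<in> E (r, s)" for i j r s
  proof -
    have "i \<in> {1..n}" "E (r, s) `` {i} \<noteq> {}" using mem[OF that] that by blast+
    then have "type_degree (Suc m) (r, s) (t i) > 0"
      using deg fin by (metis card_gt_0_iff)
    then show ?thesis by (rule type_degree_pos) (auto simp: edge_type_def)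
  qed
  have rev: "(j, i) \<in> E (s, r)" if "(i, j) \<in> E (r, s)" for i j r s
    using that E(2)[of "(r, s)"] by auto
  \<comment> \<open>The arc and its reverse place \<open>(r, s)\<close> at \<open>t i\<close> and
    \<open>(s, r)\<close> at \<open>t j\<close>, the situation of
    \<open>edge_type_unique\<close>.\<close>
  have uniq: "\<tau> = \<tau>'" if "(i, j) \<in> E \<tau>" "(i, j) \<in> E \<tau>'" for i j \<tau> \<tau>'
  proof (cases \<tau>; cases \<tau>')
    fix r s r' s' assume \<tau>: "\<tau> = (r, s)" "\<tau>' = (r', s')"
    have "i \<in> {1..n}" "j \<in> {1..n}" using mem[OF that(1)] by blast+
    then have "depth (t i) \<le> Suc m" "depth (t j) \<le> Suc m" using depth by auto
    then have "r = r' \<and> s = s'"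
      using child[of i j r s] child[of j i s r] child[of i j r' s'] child[of j i s' r'] rev that
      unfolding \<tau> by (intro edge_type_unique[of "t i" m "t j"]) auto
    then show ?thesis by (simp add: \<tau>)
  qed
  \<comment> \<open>The branch of \<open>t i\<close> that the arc from \<open>i\<close> to
    \<open>j\<close> must lead to; meaningful only for arcs of \<open>G\<close>, where
    \<open>uniq\<close> justifies \<open>THE\<close>.\<close>
  define \<sigma> where "\<sigma> i j = snd (THE \<tau>. (i, j) \<in> E \<tau>)" for i j
  have \<sigma>: "\<sigma> i j = s" if "(i, j) \<in> E (r, s)" for i j r s
  proof -
    have "(THE \<tau>. (i, j) \<in> E \<tau>) = (r, s)" using that uniq by blast
    then show ?thesis by (simp add: \<sigma>_def)
  qed
  have \<sigma>_type: "(i, j) \<in> E (\<sigma> j i, \<sigma> i j)" if ij: "(i, j) \<in> G" for i j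
  proof -
    obtain r s where "(i, j) \<in> E (r, s)" using ij by (auto simp: G_def)
    then show ?thesis using \<sigma> rev by metis
  qed
  have finG: "finite (G `` {i})" for i
    using finite_simple_graph[OF G] by (rule finite_Image)
  \<comment> \<open>The multiplicity of \<open>s\<close> in \<open>t i\<close> is the out-degree of
    \<open>i\<close> in the digraph of the one type at \<open>t i\<close> with second component
    \<open>s\<close>.\<close>
  have children: "children (t i) = image_mset (\<sigma> i) (mset_set (G `` {i}))" if i: "i \<in> {1..n}" for i
  proof (rule multiset_eqI)
    fix s
    have "E (edge_type (Suc m) (t i) s) `` {i} = {j \<in> G `` {i}. \<sigma> i j = s}"
    proof (intro equalityI subsetI)
      fix j assume "j \<in> E (edge_type (Suc m) (t i) s) `` {i}"
      then show "j \<in> {j \<in> G `` {i}. \<sigma> i j = s}"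
        using \<sigma> by (auto simp: G_def edge_type_def)
    next
      fix j assume "j \<in> {j \<in> G `` {i}. \<sigma> i j = s}"
      then have "(i, j) \<in> E (\<sigma> j i, s)" using \<sigma>_type by auto
      then show "j \<in> E (edge_type (Suc m) (t i) s) `` {i}" using child by fastforce
    qed
    then have "count (children (t i)) s = card {j \<in> G `` {i}. \<sigma> i j = s}"
      using deg[OF i] type_degree_edge_type by metis
    then show "count (children (t i)) s = count (image_mset (\<sigma> i) (mset_set (G `` {i}))) s"
      by (simp only: count_image_mset_set[OF finG])
  qed
  \<comment> \<open>By the reverse arc, \<open>\<sigma> i j\<close> is the ball of radius
    \<open>m\<close> in \<open>t j\<close> without its branch towards \<open>i\<close>. Its branches
    are thus truncations of the \<open>\<sigma> j l\<close> with \<open>l \<noteq> i\<close>,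
    matching the recursion of \<open>branch\<close>.\<close>
  have branch: "k \<le> m \<Longrightarrow> (i, j) \<in> G \<Longrightarrow> tree_ball k (\<sigma> i j) = branch k G i j" for k i j
  proof (induction k arbitrary: i j)
    case (Suc k)
    have ij: "(i, j) \<in> E (\<sigma> j i, \<sigma> i j)" using \<sigma>_type Suc.prems by blast
    then have "j \<in> {1..n}" using mem by blast
    note ch = children[OF this]
    have ji: "(j, i) \<in> G" using G Suc.prems by (auto simp: simple_graph_def sym_def)
    have "\<sigma> i j = tree_ball m (Node (children (t j) - {#\<sigma> j i#}))"
      using child[OF rev[OF ij]] by (simp add: edge_type_def)
    also have "children (t j) - {#\<sigma> j i#} = image_mset (\<sigma> j) (mset_set (G `` {j} - {i}))"
      unfolding ch using mset_set.remove[OF finG, of i j] ji by simp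
    finally have "tree_ball (Suc k) (\<sigma> i j) =
        tree_ball (Suc k) (Node (image_mset (\<sigma> j) (mset_set (G `` {j} - {i}))))"
      using Suc.prems(1) by (metis tree_ball_tree_ball)
    also have "\<dots> = Node (image_mset (\<lambda>l. tree_ball k (\<sigma> j l)) (mset_set (G `` {j} - {i})))"
      by (simp add: multiset.map_comp comp_def)
    also have "image_mset (\<lambda>l. tree_ball k (\<sigma> j l)) (mset_set (G `` {j} - {i})) =
        image_mset (branch k G j) (mset_set (G `` {j} - {i}))"
      using Suc.IH Suc.prems(1) finG by (intro image_mset_cong) auto
    finally show ?case by simp
  qed simp
  have "t i = cover_tree m G i" if i: "i \<in> {1..n}" for i
  proof -
    have "t i = tree_ball (Suc m) (t i)" by (rule tree_ball_depth[OF depth[OF i], symmetric])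
    also have "\<dots> = Node (image_mset (\<lambda>j. tree_ball m (\<sigma> i j)) (mset_set (G `` {i})))"
      by (simp add: children[OF i] multiset.map_comp comp_def)
    also have "image_mset (\<lambda>j. tree_ball m (\<sigma> i j)) (mset_set (G `` {i})) =
        image_mset (branch m G i) (mset_set (G `` {i}))"
      using branch finG by (intro image_mset_cong) auto
    finally show ?thesis by (simp add: cover_tree_def)
  qed
  then show ?thesis using graphical_nbhd_iff_cover_tree[of n t m, OF depth] G by blast
qed

theorem theorem1p3:
  fixes h n :: nat and t :: "nat \<Rightarrow> rtree" and A :: "(rtree \<times> rtree) set"
  assumes "h \<ge> 1" and "n \<ge> 1"
    and "\<And>i. i \<in> {1..n} \<Longrightarrow> depth (t i) \<le> h"
    and "orientation (types h n t) A"
  shows "graphical_nbhd h n t \<longleftrightarrow>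
    (\<forall>\<tau> \<in> diagonal_types h n t. graphical_seq n (\<lambda>i. type_degree h \<tau> (t i))) \<and>
    (\<forall>\<tau> \<in> A. digraphical_seq n (\<lambda>i. type_degree h \<tau> (t i))
                             (\<lambda>i. type_degree h (prod.swap \<tau>) (t i)))"
proof -
  \<comment> \<open>Neighborhoods of depth \<open>h\<close> correspond to
    \<open>cover_tree m\<close>, whose root has branches of depth at most \<open>m\<close>.\<close>
  obtain m where h: "h = Suc m" using assms(1) by (cases h) auto
  have depth: "\<And>i. i \<in> {1..n} \<Longrightarrow> depth (t i) \<le> Suc m" using assms(3) h by simp
  show ?thesis
  proof
    assume "graphical_nbhd h n t"
    then obtain G where G: "simple_graph n G" "\<And>i. i \<in> {1..n} \<Longrightarrow> t i = cover_tree m G i"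
      using graphical_nbhd_iff_cover_tree[of n t m, OF depth] unfolding h by blast
    show "(\<forall>\<tau> \<in> diagonal_types h n t. graphical_seq n (\<lambda>i. type_degree h \<tau> (t i))) \<and>
      (\<forall>\<tau> \<in> A. digraphical_seq n (\<lambda>i. type_degree h \<tau> (t i))
                             (\<lambda>i. type_degree h (prod.swap \<tau>) (t i)))"
      using cover_tree_type_degrees[OF G] by (auto simp: h diagonal_types_def)
  next
    assume "(\<forall>\<tau> \<in> diagonal_types h n t. graphical_seq n (\<lambda>i. type_degree h \<tau> (t i))) \<and>
      (\<forall>\<tau> \<in> A. digraphical_seq n (\<lambda>i. type_degree h \<tau> (t i))
                             (\<lambda>i. type_degree h (prod.swap \<tau>) (t i)))"
    then obtain E where "\<And>\<tau>. simple_digraph n (E \<tau>)" "\<And>\<tau>. E (prod.swap \<tau>) = (E \<tau>)\<inverse>"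
      "\<And>\<tau> i. i \<in> {1..n} \<Longrightarrow> card (E \<tau> `` {i}) = type_degree h \<tau> (t i)"
      using type_graphs[OF assms(4)] by blast
    then show "graphical_nbhd h n t"
      unfolding h by (intro type_graphs_imp_graphical_nbhd[of n t m, OF depth])
  qed
qed

end
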